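(* Let $\bar\triangle=\{\Delta_1,\dots,\Delta_n\}$ be a strip of $n$ triangles with vertices $V_1,\dots,V_{n+2}$ and let $\{\bar\triangle,\mathcal A\}$ be an exact problem (i.e. $\mathcal A\subset|\bar\triangle|$ consists of exactly $n+2$ nodes). Assume that a triangle $\Delta_k$, $1\le k\le n$, contains exactly $3$ nodes of $\mathcal A$, and these are non-collinear. Then the problem $\{\bar\triangle,\mathcal A\}$ is poised if and only if both of the following reduced problems are exact and poised: $$\Big\{\bar\triangle_1^{k-1},\ \mathcal A_1^{k-1}\cup\{V_k,V_{k+1}\}\Big\},\qquad \Big\{\bar\triangle_{k+1}^{n},\ \mathcal A_{k+1}^{n}\cup\{V_{k+1},V_{k+2}\}\Big\}.$$ Here if $k=1$ the first reduced problem is absent (no condition), and if $k=n$ the second reduced problem is absent (no condition).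
   Context: A strip of triangles: $n\ge1$ and $V_1,\dots,V_{n+2}$ are points in the plane such that the closed triangles $\Delta_i=[V_i,V_{i+1},V_{i+2}]$, $i=1,\dots,n$, are nondegenerate and: $\Delta_i\cap\Delta_{i+1}$ is exactly the common side $[V_{i+1},V_{i+2}]$; $\Delta_i\cap\Delta_{i+2}=\{V_{i+2}\}$; all other pairs of distinct triangles are disjoint. The strip is $\bar\triangle=\{\Delta_1,\dots,\Delta_n\}$ and $|\bar\triangle|=\bigcup_{i=1}^n\Delta_i$. For $1\le i\le j\le n$, $\bar\triangle_i^j=\{\Delta_i,\dots,\Delta_j\}$, itself a strip, $|\bar\triangle_i^j|$ is the union of its triangles, and $\mathcal A_i^j=\mathcal A\cap|\bar\triangle_i^j|$ is the set of all nodes of $\mathcal A$ lying in it. $S(\bar\triangle)$ is the linear space of continuous functions $s:|\bar\triangle|\to\mathbb R$ whose restriction to each $\Delta_i$ is a polynomial of total degree at most $1$ in two variables. For a finite set of (distinct) nodes $\mathcal A=\{A_1,\dots,A_M\}\subset|\bar\triangle|$, the interpolation problem $\{\bar\triangle,\mathcal A\}$ is poised if for all real $c_1,\dots,c_M$ there is exactly one $s\in S(\bar\triangle)$ with $s(A_i)=c_i$ for all $i$. For a strip of $n$ triangles the problem is exact if $\#\mathcal A=n+2$; the same terminology is used for substrips, with $n$ replaced by their number of triangles.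
   Formalization: As stated, "only if" fails when a node lies inside a side Δ_k shares with a neighbour. Proved: the equivalence if no such node exists; the "if" part always; and the equivalence in all cases with the nodes of Δ_k removed from 𝒜 in the reduced node sets. *)

theory Defs
  imports "HOL-Analysis.Analysis"
begin

text \<open>
  A strip is given by its vertices \<open>V 1, \<dots>, V (n+2)\<close>; other values of \<open>V\<close> are irrelevant.
  The substrip consisting of the triangles with indices \<open>i, \<dots>, j\<close> is referred to by \<open>V i j\<close>,
  so the whole strip is \<open>V 1 n\<close>.
\<close>

definition strip_triangle :: "(nat \<Rightarrow> real^2) \<Rightarrow> nat \<Rightarrow> (real^2) set" where
  "strip_triangle V i = convex hull {V i, V (i+1), V (i+2)}"

definition strip :: "(nat \<Rightarrow> real^2) \<Rightarrow> nat \<Rightarrow> bool" where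
  "strip V n \<longleftrightarrow>
     n \<ge> 1 \<and>
     (\<forall>i\<in>{1..n}. \<not> collinear {V i, V (i+1), V (i+2)}) \<and>
     (\<forall>i. 1 \<le> i \<and> i + 1 \<le> n \<longrightarrow>
        strip_triangle V i \<inter> strip_triangle V (i+1) = closed_segment (V (i+1)) (V (i+2))) \<and>
     (\<forall>i. 1 \<le> i \<and> i + 2 \<le> n \<longrightarrow> strip_triangle V i \<inter> strip_triangle V (i+2) = {V (i+2)}) \<and>
     (\<forall>i j. 1 \<le> i \<and> i + 3 \<le> j \<and> j \<le> n \<longrightarrow> strip_triangle V i \<inter> strip_triangle V j = {})"

definition carrier_set :: "(nat \<Rightarrow> real^2) \<Rightarrow> nat \<Rightarrow> nat \<Rightarrow> (real^2) set" where
  "carrier_set V i j = (\<Union>l\<in>{i..j}. strip_triangle V l)"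

definition nodes_in :: "(nat \<Rightarrow> real^2) \<Rightarrow> nat \<Rightarrow> nat \<Rightarrow> (real^2) set \<Rightarrow> (real^2) set" where
  "nodes_in V i j A = A \<inter> carrier_set V i j"

text \<open>
  A function on the union of the triangles is represented by its \<^const>\<open>extensional\<close> extension
  (equal to \<^const>\<open>undefined\<close> elsewhere), so that equality of such functions is equality in HOL.
\<close>

definition spline_space :: "(nat \<Rightarrow> real^2) \<Rightarrow> nat \<Rightarrow> nat \<Rightarrow> (real^2 \<Rightarrow> real) set" where
  "spline_space V i j =
     {s \<in> extensional (carrier_set V i j).
        continuous_on (carrier_set V i j) s \<and>
        (\<forall>l\<in>{i..j}. \<exists>a b c. \<forall>p\<in>strip_triangle V l. s p = a + b * p$1 + c * p$2)}"

text \<open>Only the values of the data function \<open>c\<close> at the nodes matter.\<close>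

definition poised :: "(nat \<Rightarrow> real^2) \<Rightarrow> nat \<Rightarrow> nat \<Rightarrow> (real^2) set \<Rightarrow> bool" where
  "poised V i j A \<longleftrightarrow>
     (\<forall>c :: real^2 \<Rightarrow> real. \<exists>!s. s \<in> spline_space V i j \<and> (\<forall>x\<in>A. s x = c x))"

definition exact_problem :: "nat \<Rightarrow> nat \<Rightarrow> (real^2) set \<Rightarrow> bool" where
  "exact_problem i j A \<longleftrightarrow> finite A \<and> card A = card {i..j} + 2"

definition reduced_problems_exact_poised ::
  "(nat \<Rightarrow> real^2) \<Rightarrow> nat \<Rightarrow> nat \<Rightarrow> (real^2) set \<Rightarrow> bool" where
  "reduced_problems_exact_poised V n k A \<longleftrightarrow>
     (k > 1 \<longrightarrow>
        exact_problem 1 (k-1) (nodes_in V 1 (k-1) A \<union> {V k, V (k+1)}) \<and>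
        poised V 1 (k-1) (nodes_in V 1 (k-1) A \<union> {V k, V (k+1)})) \<and>
     (k < n \<longrightarrow>
        exact_problem (k+1) n (nodes_in V (k+1) n A \<union> {V (k+1), V (k+2)}) \<and>
        poised V (k+1) n (nodes_in V (k+1) n A \<union> {V (k+1), V (k+2)}))"

text \<open>
  A node \<open>A\<^sub>1\<close> in the relative interior of a side that triangle \<open>k\<close> shares with a neighbour lies
  in the neighbouring substrip as well, so the reduced node set contains \<open>A\<^sub>1\<close> together with both
  end points of the side: three collinear nodes on one side, hence a reduced problem that is never
  poised. The full problem may nevertheless be poised. Example: \<open>n = 2\<close>, \<open>k = 1\<close>, vertices
  \<open>(0,0), (1,0), (0,1), (1,1)\<close>, nodes \<open>(0,0), (1/2,0), (1/2,1/2), (1,1)\<close>. The following condition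
  excludes this situation; the outer side \<open>[V k, V (k+2)]\<close> and, for \<open>k = 1\<close> or \<open>k = n\<close>, the side
  without neighbour are not restricted.
\<close>

definition no_node_inside_shared_sides ::
  "(nat \<Rightarrow> real^2) \<Rightarrow> nat \<Rightarrow> nat \<Rightarrow> (real^2) set \<Rightarrow> bool" where
  "no_node_inside_shared_sides V n k A \<longleftrightarrow>
     (k > 1 \<longrightarrow> A \<inter> open_segment (V k) (V (k+1)) = {}) \<and>
     (k < n \<longrightarrow> A \<inter> open_segment (V (k+1)) (V (k+2)) = {})"

end

theory Submission
  imports Defs
begin

text \<open>
  An affine function on the plane is determined by its values at three noncollinear points, and
  these values can be prescribed. Hence the three nodes in the triangle \<open>k\<close> decouple the strip: a
  solution is a fixed affine function on that triangle together with a spline on the part before it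
  and one on the part after it. Each part meets the triangle \<open>k\<close> along one common side, where both
  pieces are affine, so continuity amounts to agreement at the two end points of that side. This
  is why the end points enter as nodes of the reduced problem and replace all nodes of the triangle
  \<open>k\<close>. If both reduced problems are uniquely solvable, their solutions can be glued to the affine
  function (\<open>unisolvent_from_parts\<close>). Conversely, if the whole problem is uniquely solvable, then a
  part inherits existence by restriction, because the affine function may take any values at
  the two end points, and it inherits uniqueness because a spline on the part that vanishes at the
  end points extends by zero (\<open>unisolvent_part\<close>).

  Exactness of the reduced problems follows by counting. There are \<open>n - 1\<close> nodes outside
  the triangle \<open>k\<close>, and each lies in exactly one part. A spline is determined by its values at the
  vertices, so a solvable problem on \<open>m\<close> triangles has at most \<open>m + 2\<close> nodes
  (\<open>card_nodes_le_if_solvable\<close>); this leaves at most \<open>k - 1\<close> nodes for one part and \<open>n - k\<close> for the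
  other, and both bounds must be attained.

  The argument concerns the nodes outside the triangle \<open>k\<close>. Keeping its nodes in the reduced
  problems changes their node sets only if a node lies inside a shared side. In that case the
  reduced problem has three nodes on one side and cannot be poised
  (\<open>no_node_inside_attached_side\<close>).
\<close>

section \<open>Affine functions of two variables\<close>

definition affine_function_on :: "(real^2) set \<Rightarrow> (real^2 \<Rightarrow> real) \<Rightarrow> bool" where
  "affine_function_on T s \<longleftrightarrow> (\<exists>a b c. \<forall>p\<in>T. s p = a + b * p$1 + c * p$2)"

lemma affine_function_on_cong:
  assumes "affine_function_on T s" and "\<And>p. p \<in> T \<Longrightarrow> t p = s p"
  shows "affine_function_on T t"
  using assms unfolding affine_function_on_def by simp

lemma affine_function_on_subset:
  assumes "affine_function_on T s" and "S \<subseteq> T"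
  shows "affine_function_on S s"
  using assms unfolding affine_function_on_def by blast

lemma affine_function_on_diff:
  assumes "affine_function_on T s" and "affine_function_on T t"
  shows "affine_function_on T (\<lambda>p. s p - t p)"
proof -
  obtain a b c a' b' c' where
    "\<forall>p\<in>T. s p = a + b * p$1 + c * p$2" "\<forall>p\<in>T. t p = a' + b' * p$1 + c' * p$2"
    using assms unfolding affine_function_on_def by blast
  then have "\<forall>p\<in>T. s p - t p = (a - a') + (b - b') * p$1 + (c - c') * p$2"
    by (simp add: algebra_simps)
  then show ?thesis unfolding affine_function_on_def by blast
qed

lemma affine_function_on_sum:
  assumes "\<And>x. x \<in> A \<Longrightarrow> affine_function_on T (s x)"
  shows "affine_function_on T (\<lambda>p. \<Sum>x\<in>A. (l x :: real) * s x p)"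
proof -
  have "\<forall>x\<in>A. \<exists>a b c. \<forall>p\<in>T. s x p = a + b * p$1 + c * p$2"
    using assms unfolding affine_function_on_def by blast
  then obtain a b c where s: "\<And>x p. x \<in> A \<Longrightarrow> p \<in> T \<Longrightarrow> s x p = a x + b x * p$1 + c x * p$2"
    by metis
  have "(\<Sum>x\<in>A. l x * s x p) =
      (\<Sum>x\<in>A. l x * a x) + (\<Sum>x\<in>A. l x * b x) * p$1 + (\<Sum>x\<in>A. l x * c x) * p$2"
    if "p \<in> T" for p
    using that by (simp add: s sum.distrib sum_distrib_left sum_distrib_right algebra_simps)
  then show ?thesis unfolding affine_function_on_def by blast
qed

lemma continuous_on_affine_function:
  assumes "affine_function_on T s"
  shows "continuous_on T s"
proof -
  obtain a b c where s: "\<forall>p\<in>T. s p = a + b * p$1 + c * p$2"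
    using assms unfolding affine_function_on_def by blast
  have "continuous_on T (\<lambda>p. a + b * p$1 + c * p$2)" by (intro continuous_intros)
  then show ?thesis using s by (simp cong: continuous_on_cong)
qed

text \<open>In this form the convexity and the dimension of hyperplanes apply to zero sets.\<close>

lemma affine_eq_zero_iff_inner:
  fixes p :: "real^2"
  shows "a + b * p$1 + c * p$2 = 0 \<longleftrightarrow> vector [b, c] \<bullet> p = - a"
  by (auto simp: inner_vec_def sum_2)

text \<open>The zero set is convex, so it contains the convex hull of the given zeros.\<close>

lemma affine_function_vanishes_on_hull:
  assumes s: "affine_function_on T s" and T: "convex hull P \<subseteq> T" and P: "\<And>x. x \<in> P \<Longrightarrow> s x = 0"
    and p: "p \<in> convex hull P"
  shows "s p = 0"
proof -
  obtain a b c where abc: "\<And>p. p \<in> T \<Longrightarrow> s p = a + b * p$1 + c * p$2"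
    using s unfolding affine_function_on_def by blast
  let ?H = "{p :: real^2. vector [b, c] \<bullet> p = - a}"
  have "P \<subseteq> T" using T hull_subset[of P convex] by blast
  have "P \<subseteq> ?H"
  proof
    fix x assume "x \<in> P"
    then have "a + b * x$1 + c * x$2 = 0" using P abc[of x] \<open>P \<subseteq> T\<close> by auto
    then show "x \<in> ?H" by (simp only: affine_eq_zero_iff_inner mem_Collect_eq)
  qed
  then have "convex hull P \<subseteq> ?H" by (rule hull_minimal) (rule convex_hyperplane)
  then have "vector [b, c] \<bullet> p = - a" using p by blast
  then have "a + b * p$1 + c * p$2 = 0" by (simp only: affine_eq_zero_iff_inner)
  then show ?thesis using p abc[of p] T by auto
qed

text \<open>The zero set of a function with nonzero gradient is a line, which cannot contain \<open>P\<close>; and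
  a constant that vanishes somewhere is zero.\<close>

lemma affine_function_vanishes_if_noncollinear_zeros:
  assumes s: "affine_function_on T s" and PT: "P \<subseteq> T" and P: "\<And>x. x \<in> P \<Longrightarrow> s x = 0"
    and nc: "\<not> collinear P" and p: "p \<in> T"
  shows "s p = 0"
proof -
  obtain a b c where abc: "\<And>p. p \<in> T \<Longrightarrow> s p = a + b * p$1 + c * p$2"
    using s unfolding affine_function_on_def by blast
  have PH: "P \<subseteq> {p :: real^2. vector [b, c] \<bullet> p = - a}"
  proof
    fix x assume "x \<in> P"
    then have "a + b * x$1 + c * x$2 = 0" using P abc[of x] PT by auto
    then show "x \<in> {p. vector [b, c] \<bullet> p = - a}"
      by (simp only: affine_eq_zero_iff_inner mem_Collect_eq)
  qed
  have v0: "(vector [b, c] :: real^2) = 0"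
  proof (rule ccontr)
    assume "(vector [b, c] :: real^2) \<noteq> 0"
    then have "aff_dim {p :: real^2. vector [b, c] \<bullet> p = - a} = 1"
      by (simp add: aff_dim_hyperplane)
    then have "collinear P"
      using aff_dim_subset[OF PH] by (simp add: collinear_aff_dim)
    then show False using nc by simp
  qed
  have "b = 0" "c = 0" using v0 by (metis vector_2 zero_index)+
  moreover have "P \<noteq> {}" using nc by auto
  ultimately have "a = 0" using PH v0 by auto
  then show ?thesis using abc[OF p] \<open>b = 0\<close> \<open>c = 0\<close> by simp
qed

lemma collinear_if_cross_product_zero:
  fixes x y z :: "real^2"
  assumes "(y$1 - x$1) * (z$2 - x$2) = (y$2 - x$2) * (z$1 - x$1)"
  shows "collinear {x, y, z}"
proof -
  have "collinear {0, y - x, z - x}"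
  proof (cases "y$1 = x$1")
    case True
    show ?thesis
    proof (cases "y$2 = x$2")
      case True
      then show ?thesis using \<open>y$1 = x$1\<close> by (simp add: collinear_lemma vec_eq_iff forall_2)
    next
      case False
      then have "z - x = ((z$2 - x$2) / (y$2 - x$2)) *\<^sub>R (y - x)"
        using True assms by (auto simp: vec_eq_iff forall_2)
      then show ?thesis by (auto simp: collinear_lemma)
    qed
  next
    case False
    then have "z$2 - x$2 = (z$1 - x$1) / (y$1 - x$1) * (y$2 - x$2)"
      using assms by (simp add: eq_divide_eq mult.commute)
    then have "z - x = ((z$1 - x$1) / (y$1 - x$1)) *\<^sub>R (y - x)"
      using False by (simp add: vec_eq_iff forall_2)
    then show ?thesis by (auto simp: collinear_lemma)
  qed
  then have "collinear {y, x, z}" by (subst collinear_3) simp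
  then show ?thesis by (simp add: insert_commute)
qed

lemma affine_interpolation_3:
  fixes P :: "(real^2) set"
  assumes card: "card P = 3" and nc: "\<not> collinear P"
  obtains q where "affine_function_on UNIV q" and "\<And>x. x \<in> P \<Longrightarrow> q x = f x"
proof -
  obtain x y z where P: "P = {x, y, z}" using card by (metis card_3_iff)
  define D where "D = (y$1 - x$1) * (z$2 - x$2) - (y$2 - x$2) * (z$1 - x$1)"
  have D: "D \<noteq> 0" using nc collinear_if_cross_product_zero[of y x z] P by (auto simp: D_def)
  \<comment> \<open>Cramer's rule for the gradient, in coordinates centred at \<open>x\<close>.\<close>
  define b where "b = ((f y - f x) * (z$2 - x$2) - (y$2 - x$2) * (f z - f x)) / D"
  define c where "c = ((y$1 - x$1) * (f z - f x) - (f y - f x) * (z$1 - x$1)) / D"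
  define q where "q p = f x + b * (p$1 - x$1) + c * (p$2 - x$2)" for p :: "real^2"
  have bD: "b * D = (f y - f x) * (z$2 - x$2) - (y$2 - x$2) * (f z - f x)"
    and cD: "c * D = (y$1 - x$1) * (f z - f x) - (f y - f x) * (z$1 - x$1)"
    using D by (simp_all add: b_def c_def)
  have "D * (q y - f y) = (b * D) * (y$1 - x$1) + (c * D) * (y$2 - x$2) + D * (f x - f y)"
    by (simp add: q_def algebra_simps)
  also have "\<dots> = 0" unfolding bD cD by (simp add: D_def algebra_simps)
  finally have qy: "q y = f y" using D by simp
  have "D * (q z - f z) = (b * D) * (z$1 - x$1) + (c * D) * (z$2 - x$2) + D * (f x - f z)"
    by (simp add: q_def algebra_simps)
  also have "\<dots> = 0" unfolding bD cD by (simp add: D_def algebra_simps)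
  finally have qz: "q z = f z" using D by simp
  have qx: "q x = f x" by (simp add: q_def)
  have "q p = (f x - b * x$1 - c * x$2) + b * p$1 + c * p$2" for p
    by (simp add: q_def algebra_simps)
  then have "affine_function_on UNIV q" unfolding affine_function_on_def by blast
  then show thesis using that[of q] qx qy qz P by blast
qed

lemma affine_interpolation_2:
  fixes x y :: "real^2"
  assumes "x \<noteq> y"
  obtains q where "affine_function_on UNIV q" and "q x = f x" and "q y = f y"
proof -
  define D where "D = (y - x) \<bullet> (y - x)"
  have D: "D \<noteq> 0" using assms by (simp add: D_def)
  define m where "m = (f y - f x) / D"
  define q where "q p = f x + m * ((y - x) \<bullet> (p - x))" for p
  have "q p = (f x - m * ((y - x) \<bullet> x)) + (m * (y$1 - x$1)) * p$1 + (m * (y$2 - x$2)) * p$2" for p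
    by (simp add: q_def inner_vec_def sum_2 algebra_simps)
  then have "affine_function_on UNIV q" unfolding affine_function_on_def by blast
  moreover have "q x = f x" by (simp add: q_def)
  moreover have "q y = f y" using D by (simp add: q_def m_def D_def[symmetric])
  ultimately show thesis using that by blast
qed

section \<open>Splines on a set of triangles\<close>

text \<open>Intervals of indices are replaced by arbitrary sets: removing a triangle from a strip leaves
  two index sets that play symmetric roles, so one argument serves for both.\<close>

definition region :: "(nat \<Rightarrow> real^2) \<Rightarrow> nat set \<Rightarrow> (real^2) set" where
  "region V I = (\<Union>l\<in>I. strip_triangle V l)"

definition splines :: "(nat \<Rightarrow> real^2) \<Rightarrow> nat set \<Rightarrow> (real^2 \<Rightarrow> real) set" where
  "splines V I =
     {s \<in> extensional (region V I).
        continuous_on (region V I) s \<and> (\<forall>l\<in>I. affine_function_on (strip_triangle V l) s)}"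

definition unisolvent :: "(nat \<Rightarrow> real^2) \<Rightarrow> nat set \<Rightarrow> (real^2) set \<Rightarrow> bool" where
  "unisolvent V I A \<longleftrightarrow>
     (\<forall>c :: real^2 \<Rightarrow> real. \<exists>!s. s \<in> splines V I \<and> (\<forall>x\<in>A. s x = c x))"

lemma carrier_set_eq_region: "carrier_set V i j = region V {i..j}"
  by (simp add: carrier_set_def region_def)

lemma poised_iff_unisolvent: "poised V i j A \<longleftrightarrow> unisolvent V {i..j} A"
  by (simp add: poised_def unisolvent_def spline_space_def splines_def
      affine_function_on_def carrier_set_eq_region)

lemma unisolventI:
  assumes "\<And>c. \<exists>s. s \<in> splines V I \<and> (\<forall>x\<in>A. s x = c x)"
    and "\<And>s t. s \<in> splines V I \<Longrightarrow> t \<in> splines V I \<Longrightarrow> \<forall>x\<in>A. s x = t x \<Longrightarrow> s = t"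
  shows "unisolvent V I A"
  unfolding unisolvent_def
proof
  fix c
  obtain s where s: "s \<in> splines V I" "\<forall>x\<in>A. s x = c x" using assms(1)[of c] by blast
  show "\<exists>!s. s \<in> splines V I \<and> (\<forall>x\<in>A. s x = c x)"
  proof (rule ex1I[of _ s])
    show "s \<in> splines V I \<and> (\<forall>x\<in>A. s x = c x)" using s by simp
    show "t = s" if "t \<in> splines V I \<and> (\<forall>x\<in>A. t x = c x)" for t
      by (rule assms(2)) (use s that in auto)
  qed
qed

lemma unisolventE:
  assumes "unisolvent V I A"
  obtains s where "s \<in> splines V I" and "\<And>x. x \<in> A \<Longrightarrow> s x = c x"
  using assms unfolding unisolvent_def by (metis (no_types, lifting))

lemma unisolvent_unique:
  assumes "unisolvent V I A" and "s \<in> splines V I" and "t \<in> splines V I"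
    and "\<And>x. x \<in> A \<Longrightarrow> s x = t x"
  shows "s = t"
  using assms unfolding unisolvent_def by (metis (no_types, lifting))

lemma region_empty [simp]: "region V {} = {}"
  by (simp add: region_def)

lemma region_insert [simp]: "region V (insert k K) = strip_triangle V k \<union> region V K"
  by (simp add: region_def)

lemma region_Un: "region V (I \<union> J) = region V I \<union> region V J"
  by (auto simp: region_def)

lemma region_mono: "J \<subseteq> I \<Longrightarrow> region V J \<subseteq> region V I"
  by (auto simp: region_def)

lemma strip_triangle_subset_region: "l \<in> I \<Longrightarrow> strip_triangle V l \<subseteq> region V I"
  by (auto simp: region_def)

lemma closed_region: "finite I \<Longrightarrow> closed (region V I)"
  unfolding region_def strip_triangle_def
  by (intro closed_UN ballI) (simp_all add: compact_imp_closed finite_imp_compact_convex_hull)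

lemma vertices_in_strip_triangle:
  "V l \<in> strip_triangle V l" "V (l+1) \<in> strip_triangle V l" "V (l+2) \<in> strip_triangle V l"
  unfolding strip_triangle_def by (auto intro!: hull_inc)

lemma spline_affine:
  "s \<in> splines V I \<Longrightarrow> l \<in> I \<Longrightarrow> affine_function_on (strip_triangle V l) s"
  by (simp add: splines_def)

lemma splines_eqI:
  assumes "s \<in> splines V I" and "t \<in> splines V I" and "\<And>p. p \<in> region V I \<Longrightarrow> s p = t p"
  shows "s = t"
  using assms by (auto simp: splines_def intro: extensionalityI)

lemma restrict_in_splines:
  assumes "continuous_on (region V I) s" and "\<And>l. l \<in> I \<Longrightarrow> affine_function_on (strip_triangle V l) s"
  shows "restrict s (region V I) \<in> splines V I"
proof -
  have "continuous_on (region V I) (restrict s (region V I))"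
    using assms(1) by (simp cong: continuous_on_cong)
  moreover have "affine_function_on (strip_triangle V l) (restrict s (region V I))" if "l \<in> I" for l
    using assms(2)[OF that]
    by (rule affine_function_on_cong) (use strip_triangle_subset_region[OF that] in auto)
  ultimately show ?thesis by (simp add: splines_def)
qed

lemma spline_restrict:
  assumes "s \<in> splines V I" and "J \<subseteq> I"
  shows "restrict s (region V J) \<in> splines V J"
  using assms region_mono[OF assms(2)]
  by (intro restrict_in_splines) (auto simp: splines_def intro: continuous_on_subset)

lemma affine_function_in_splines:
  assumes "affine_function_on UNIV q"
  shows "restrict q (region V I) \<in> splines V I"
  using assms
  by (intro restrict_in_splines)
     (auto intro: continuous_on_affine_function affine_function_on_subset)

lemma spline_diff:
  assumes "s \<in> splines V I" and "t \<in> splines V I"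
  shows "restrict (\<lambda>p. s p - t p) (region V I) \<in> splines V I"
  using assms
  by (intro restrict_in_splines)
     (auto simp: splines_def intro: continuous_on_diff affine_function_on_diff)

text \<open>The regions are closed, so continuity on each of them gives continuity on the union.\<close>

lemma spline_glue:
  assumes "finite I" and "finite J" and s: "s \<in> splines V I" and t: "t \<in> splines V J"
    and agree: "\<And>p. p \<in> region V I \<Longrightarrow> p \<in> region V J \<Longrightarrow> s p = t p"
  obtains u where "u \<in> splines V (I \<union> J)"
    and "\<And>p. p \<in> region V I \<Longrightarrow> u p = s p" and "\<And>p. p \<in> region V J \<Longrightarrow> u p = t p"
proof -
  let ?u = "\<lambda>p. if p \<in> region V I then s p else t p"
  have uI: "\<And>p. p \<in> region V I \<Longrightarrow> ?u p = s p" by simp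
  have uJ: "\<And>p. p \<in> region V J \<Longrightarrow> ?u p = t p" using agree by simp
  have "continuous_on (region V I \<union> region V J) ?u"
    using assms by (intro continuous_on_cases closed_region) (auto simp: splines_def)
  moreover have "affine_function_on (strip_triangle V l) ?u" if "l \<in> I \<union> J" for l
  proof (cases "l \<in> I")
    case True
    then show ?thesis
      using spline_affine[OF s True] strip_triangle_subset_region[OF True]
      by (rule_tac affine_function_on_cong[of _ s]) auto
  next
    case False
    then have "l \<in> J" using that by simp
    then show ?thesis
      using spline_affine[OF t \<open>l \<in> J\<close>] strip_triangle_subset_region[OF \<open>l \<in> J\<close>] uJ
      by (rule_tac affine_function_on_cong[of _ t]) blast+
  qed
  moreover have "?u \<in> extensional (region V I \<union> region V J)"
    using s t by (auto simp: splines_def extensional_def)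
  ultimately have "?u \<in> splines V (I \<union> J)" by (simp add: splines_def region_Un)
  then show thesis using that uI uJ by blast
qed

section \<open>The number of nodes of a solvable problem\<close>

text \<open>Gaussian elimination, one equation at a time.\<close>

lemma nontrivial_solution_of_underdetermined_system:
  fixes f :: "'a \<Rightarrow> 'b \<Rightarrow> real"
  assumes "finite W" and "finite A" and "card W < card A"
  shows "\<exists>l. (\<exists>x\<in>A. l x \<noteq> 0) \<and> (\<forall>w\<in>W. (\<Sum>x\<in>A. l x * f x w) = 0)"
  using assms
proof (induction W arbitrary: A f rule: finite_induct)
  case empty
  then have "A \<noteq> {}" by auto
  then show ?case by (intro exI[of _ "\<lambda>_. 1"]) auto
next
  case (insert w W)
  show ?case
  proof (cases "\<forall>x\<in>A. f x w = 0")
    case True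
    obtain l where "\<exists>x\<in>A. l x \<noteq> 0" "\<forall>w\<in>W. (\<Sum>x\<in>A. l x * f x w) = 0"
      using insert.IH[of A f] insert.prems insert.hyps by auto
    then show ?thesis using True by (intro exI[of _ l]) auto
  next
    case False
    then obtain z where z: "z \<in> A" "f z w \<noteq> 0" by blast
    let ?B = "A - {z}"
    define g where "g x v = f x v - f x w / f z w * f z v" for x v
    have "card W < card ?B" using insert z by simp
    then obtain l where l: "\<exists>x\<in>?B. l x \<noteq> 0" "\<forall>v\<in>W. (\<Sum>x\<in>?B. l x * g x v) = 0"
      using insert.IH[of ?B g] insert.prems by auto
    \<comment> \<open>The value at the pivot \<open>z\<close> is what the equation \<open>w\<close> forces.\<close>
    define m where "m = l(z := - (\<Sum>x\<in>?B. l x * f x w) / f z w)"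
    have m: "(\<Sum>x\<in>A. m x * f x v) = m z * f z v + (\<Sum>x\<in>?B. l x * f x v)" for v
    proof -
      have "(\<Sum>x\<in>?B. m x * f x v) = (\<Sum>x\<in>?B. l x * f x v)"
        by (rule sum.cong) (auto simp: m_def)
      then show ?thesis using z insert.prems by (simp add: sum.remove)
    qed
    have "(\<Sum>x\<in>A. m x * f x w) = 0" unfolding m using z by (simp add: m_def)
    moreover have "(\<Sum>x\<in>A. m x * f x v) = 0" if "v \<in> W" for v
    proof -
      have "(\<Sum>x\<in>?B. l x * g x v) =
          (\<Sum>x\<in>?B. l x * f x v) - (\<Sum>x\<in>?B. l x * f x w) / f z w * f z v"
        by (simp add: g_def right_diff_distrib sum_subtractf sum_distrib_right sum_divide_distrib
            mult.assoc)
      then show ?thesis using l(2) that unfolding m by (simp add: m_def)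
    qed
    moreover have "\<exists>x\<in>A. m x \<noteq> 0" using l(1) by (auto simp: m_def)
    ultimately show ?thesis by (intro exI[of _ m]) auto
  qed
qed

text \<open>A spline is determined by its values at the vertices of its triangles, so the space of
  splines has at most as many dimensions as there are vertices. With more nodes, a nontrivial
  combination of the cardinal splines \<open>s\<^sub>x(y) = [x = y]\<close> would vanish at every vertex and hence
  everywhere.\<close>

lemma card_nodes_le_if_solvable:
  assumes ij: "i \<le> j" and "finite A" and sub: "A \<subseteq> region V {i..j}"
    and solv: "\<And>c. \<exists>s\<in>splines V {i..j}. \<forall>x\<in>A. s x = c x"
  shows "card A \<le> card {i..j} + 2"
proof (rule ccontr)
  assume less: "\<not> card A \<le> card {i..j} + 2"
  have "card (V ` {i..j+2}) \<le> card {i..j+2}" by (rule card_image_le) simp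
  then have "card (V ` {i..j+2}) < card A" using less ij by simp
  have "\<forall>x. \<exists>s. s \<in> splines V {i..j} \<and> (\<forall>y\<in>A. s y = (if y = x then 1 else 0))"
    using solv[of "\<lambda>y. if y = x then 1 else 0" for x] by blast
  then obtain s where s: "\<And>x. s x \<in> splines V {i..j}"
    and sA: "\<And>x y. y \<in> A \<Longrightarrow> s x y = (if y = x then 1 else 0)" by metis
  obtain l where "\<exists>x\<in>A. l x \<noteq> 0" and l0: "\<forall>w\<in>V ` {i..j+2}. (\<Sum>x\<in>A. l x * s x w) = 0"
    using nontrivial_solution_of_underdetermined_system[of "V ` {i..j+2}" A s]
      \<open>card (V ` {i..j+2}) < card A\<close> \<open>finite A\<close> by auto
  then obtain y where y: "y \<in> A" "l y \<noteq> 0" by blast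
  obtain m where m: "m \<in> {i..j}" "y \<in> strip_triangle V m" using sub y by (auto simp: region_def)
  have "affine_function_on (strip_triangle V m) (\<lambda>p. \<Sum>x\<in>A. l x * s x p)"
    by (rule affine_function_on_sum) (rule spline_affine[OF s m(1)])
  moreover have "(\<Sum>x\<in>A. l x * s x p) = 0" if "p \<in> {V m, V (m+1), V (m+2)}" for p
    using that l0 m(1) by auto
  ultimately have "(\<Sum>x\<in>A. l x * s x y) = 0"
    using affine_function_vanishes_on_hull[where P = "{V m, V (m+1), V (m+2)}" and p = y
        and s = "\<lambda>p. \<Sum>x\<in>A. l x * s x p" and T = "strip_triangle V m"] m(2)
    by (auto simp: strip_triangle_def)
  moreover have "(\<Sum>x\<in>A. l x * s x y) = l y"
    using y \<open>finite A\<close> by (simp add: sA if_distrib cong: if_cong)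
  ultimately show False using y by simp
qed

section \<open>Removing a triangle with three noncollinear nodes\<close>

text \<open>How a part of the strip meets the triangle \<open>k\<close>: along a whole side, which belongs to a single
  triangle of that part, so that splines on the part are affine along the side.\<close>

definition attached :: "(nat \<Rightarrow> real^2) \<Rightarrow> nat \<Rightarrow> nat set \<Rightarrow> real^2 \<Rightarrow> real^2 \<Rightarrow> bool" where
  "attached V k J a b \<longleftrightarrow>
     region V J \<inter> strip_triangle V k = closed_segment a b \<and>
     (\<exists>l\<in>J. closed_segment a b \<subseteq> strip_triangle V l)"

lemma spline_vanishes_on_attached_side:
  assumes "attached V k J a b" and "s \<in> splines V J" and "s a = 0" and "s b = 0"
    and "p \<in> closed_segment a b"
  shows "s p = 0"
proof -
  obtain l where "l \<in> J" and l: "closed_segment a b \<subseteq> strip_triangle V l"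
    using assms(1) unfolding attached_def by blast
  then have "affine_function_on (strip_triangle V l) s" using spline_affine assms by blast
  from affine_function_vanishes_on_hull[OF this, of "{a, b}" p] show ?thesis
    using assms l by (auto simp: segment_convex_hull)
qed

text \<open>The difference is again a spline on the part, so the previous lemma applies. This is what makes
  the spline and an affine function on the triangle \<open>k\<close> fit together continuously.\<close>

lemma spline_eq_affine_on_attached_side:
  assumes att: "attached V k J a b" and s: "s \<in> splines V J" and q: "affine_function_on UNIV q"
    and "s a = q a" and "s b = q b" and p: "p \<in> closed_segment a b"
  shows "s p = q p"
proof -
  have sub: "closed_segment a b \<subseteq> region V J" using att unfolding attached_def by blast
  then have ends: "a \<in> region V J" "b \<in> region V J" "p \<in> region V J" using p by auto
  define d where "d = restrict (\<lambda>p. s p - restrict q (region V J) p) (region V J)"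
  have d: "d \<in> splines V J"
    unfolding d_def by (rule spline_diff[OF s affine_function_in_splines[OF q]])
  have "d a = 0" "d b = 0" using assms(4,5) ends by (simp_all add: d_def)
  then have "d p = 0" using spline_vanishes_on_attached_side[OF att d _ _ p] by blast
  then show ?thesis using ends by (simp add: d_def)
qed

text \<open>Data on the reduced problem is solvable because an affine function with the data at \<open>a\<close> and
  \<open>b\<close> can be prescribed at the nodes of the triangle \<open>k\<close>, which then force it on that triangle.
  Uniqueness transfers because a spline on the part that vanishes at \<open>a\<close> and \<open>b\<close> extends by zero.\<close>

lemma unisolvent_part:
  assumes fin: "finite J" "finite K" and att: "attached V k J a b" and "a \<noteq> b"
    and sep: "region V J \<inter> region V K \<subseteq> strip_triangle V k"
    and nc: "\<not> collinear (A \<inter> strip_triangle V k)"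
    and uni: "unisolvent V (J \<union> ({k} \<union> K)) A"
  shows "unisolvent V J ((A - strip_triangle V k) \<inter> region V J \<union> {a, b})" (is "unisolvent V J ?N")
proof -
  let ?I = "J \<union> ({k} \<union> K)"
  have seg: "region V J \<inter> strip_triangle V k = closed_segment a b"
    using att by (simp add: attached_def)
  have ab: "a \<in> region V J" "b \<in> region V J" "a \<in> strip_triangle V k" "b \<in> strip_triangle V k"
    using seg by (metis IntE ends_in_segment)+
  have exist: "\<exists>s. s \<in> splines V J \<and> (\<forall>x\<in>?N. s x = c x)" for c
  proof -
    obtain q where q: "affine_function_on UNIV q" "q a = c a" "q b = c b"
      using affine_interpolation_2[OF \<open>a \<noteq> b\<close>] by blast
    obtain s where s: "s \<in> splines V ?I"
      and sA: "\<And>x. x \<in> A \<Longrightarrow> s x = (if x \<in> strip_triangle V k then q x else c x)"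
      using unisolventE[OF uni, where c = "\<lambda>x. if x \<in> strip_triangle V k then q x else c x"] by blast
    have "affine_function_on (strip_triangle V k) (\<lambda>p. s p - q p)"
      using spline_affine[OF s, of k] q(1)
      by (intro affine_function_on_diff) (auto intro: affine_function_on_subset)
    from affine_function_vanishes_if_noncollinear_zeros[OF this _ _ nc]
    have "s p = q p" if "p \<in> strip_triangle V k" for p using sA that by auto
    then have "\<forall>x\<in>?N. restrict s (region V J) x = c x" using ab q sA by auto
    then show ?thesis using spline_restrict[OF s, of J] by blast
  qed
  have unique: "s = t" if s: "s \<in> splines V J" and t: "t \<in> splines V J"
    and st: "\<forall>x\<in>?N. s x = t x" for s t
  proof -
    define d where "d = restrict (\<lambda>p. s p - t p) (region V J)"
    have d: "d \<in> splines V J" unfolding d_def by (rule spline_diff[OF s t])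
    have "d p = 0" if "p \<in> closed_segment a b" for p
      by (rule spline_vanishes_on_attached_side[OF att d _ _ that]) (use st ab in \<open>simp_all add: d_def\<close>)
    then have dk: "d p = 0" if "p \<in> region V J" "p \<in> strip_triangle V k" for p
      using that seg by blast
    have affine0: "affine_function_on UNIV (\<lambda>_. 0)" unfolding affine_function_on_def
      by (intro exI[of _ 0]) simp
    have zero: "restrict (\<lambda>_. 0) (region V I) \<in> splines V I" for I
      by (rule affine_function_in_splines[OF affine0])
    have "d p = restrict (\<lambda>_. 0) (region V ({k} \<union> K)) p"
      if "p \<in> region V J" "p \<in> region V ({k} \<union> K)" for p
      using that dk sep by (auto simp: region_Un)
    then obtain u where u: "u \<in> splines V ?I" and uJ: "\<And>p. p \<in> region V J \<Longrightarrow> u p = d p"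
      and uK: "\<And>p. p \<in> region V ({k} \<union> K) \<Longrightarrow> u p = restrict (\<lambda>_. 0) (region V ({k} \<union> K)) p"
      using spline_glue[OF fin(1) _ d zero, of "{k} \<union> K"] fin(2) by blast
    have "u = restrict (\<lambda>_. 0) (region V ?I)"
    proof (rule unisolvent_unique[OF uni u zero])
      fix x assume x: "x \<in> A"
      show "u x = restrict (\<lambda>_. 0) (region V ?I) x"
      proof (cases "x \<in> region V J")
        case True
        have "d x = 0"
          using dk[OF True] st x True by (cases "x \<in> strip_triangle V k") (auto simp: d_def)
        then show ?thesis using uJ[OF True] True by (simp add: region_Un)
      next
        case False
        then show ?thesis
          using uK[of x] u by (cases "x \<in> region V ({k} \<union> K)")
            (auto simp: region_Un splines_def extensional_def)
      qed
    qed
    then have "d p = 0" if "p \<in> region V J" for p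
      using uJ[OF that] that by (simp add: region_Un)
    then show "s = t" using splines_eqI[OF s t] by (force simp: d_def)
  qed
  show ?thesis by (rule unisolventI[OF exist unique])
qed

text \<open>The case \<open>J = {}\<close> is the absent reduced problem when the triangle \<open>k\<close> is at an end of the strip.
  Otherwise the reduced problem is solved with the values of \<open>q\<close> at \<open>a\<close> and \<open>b\<close>.\<close>

lemma extend_affine_to_part:
  assumes part: "J = {} \<or>
      attached V k J a b \<and> unisolvent V J ((A - strip_triangle V k) \<inter> region V J \<union> {a, b})"
    and q: "affine_function_on UNIV q"
  obtains s where "s \<in> splines V J"
    and "\<And>x. x \<in> A - strip_triangle V k \<Longrightarrow> x \<in> region V J \<Longrightarrow> s x = c x"
    and "\<And>p. p \<in> region V J \<Longrightarrow> p \<in> strip_triangle V k \<Longrightarrow> s p = q p"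
proof (cases "J = {}")
  case True
  then show ?thesis using that[OF affine_function_in_splines[OF q, of V J]] by simp
next
  case False
  then have att: "attached V k J a b"
    and uni: "unisolvent V J ((A - strip_triangle V k) \<inter> region V J \<union> {a, b})" using part by auto
  have seg: "region V J \<inter> strip_triangle V k = closed_segment a b"
    using att by (simp add: attached_def)
  have ab: "a \<in> strip_triangle V k" "b \<in> strip_triangle V k"
    using seg by (metis IntE ends_in_segment)+
  let ?c = "\<lambda>x. if x \<in> strip_triangle V k then q x else c x"
  obtain s where s: "s \<in> splines V J"
    and sN: "\<And>x. x \<in> (A - strip_triangle V k) \<inter> region V J \<union> {a, b} \<Longrightarrow> s x = ?c x"
    using unisolventE[OF uni, where c = ?c] by blast
  have "s p = q p" if "p \<in> region V J" "p \<in> strip_triangle V k" for p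
    using spline_eq_affine_on_attached_side[OF att s q] sN[of a] sN[of b] ab that seg by auto
  then show ?thesis using that[OF s] sN by auto
qed

lemma part_unique:
  assumes part: "J = {} \<or>
      attached V k J a b \<and> unisolvent V J ((A - strip_triangle V k) \<inter> region V J \<union> {a, b})"
    and "s \<in> splines V I" and "t \<in> splines V I" and "J \<subseteq> I"
    and A: "\<And>x. x \<in> A \<Longrightarrow> s x = t x" and k: "\<And>p. p \<in> strip_triangle V k \<Longrightarrow> s p = t p"
    and p: "p \<in> region V J"
  shows "s p = t p"
proof -
  have att: "attached V k J a b"
    and uni: "unisolvent V J ((A - strip_triangle V k) \<inter> region V J \<union> {a, b})" using part p by auto
  have ab: "{a, b} \<subseteq> region V J \<inter> strip_triangle V k" using att by (auto simp: attached_def)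
  have "restrict s (region V J) = restrict t (region V J)"
    by (rule unisolvent_unique[OF uni]) (use assms ab in \<open>auto intro: spline_restrict\<close>)
  then show ?thesis using p by (metis restrict_apply')
qed

text \<open>The three nodes determine the spline on the triangle \<open>k\<close>, and with it the data of the two
  reduced problems at the end points of the shared sides; their solutions then fit together.\<close>

lemma unisolvent_from_parts:
  assumes fin: "finite J" "finite K"
    and J: "J = {} \<or>
      attached V k J a b \<and> unisolvent V J ((A - strip_triangle V k) \<inter> region V J \<union> {a, b})"
    and K: "K = {} \<or>
      attached V k K a' b' \<and> unisolvent V K ((A - strip_triangle V k) \<inter> region V K \<union> {a', b'})"
    and sep: "region V J \<inter> region V K \<subseteq> strip_triangle V k"
    and card: "card (A \<inter> strip_triangle V k) = 3" and nc: "\<not> collinear (A \<inter> strip_triangle V k)"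
    and sub: "A \<subseteq> region V (J \<union> ({k} \<union> K))"
  shows "unisolvent V (J \<union> ({k} \<union> K)) A"
proof -
  let ?I = "J \<union> ({k} \<union> K)"
  have exist: "\<exists>s. s \<in> splines V ?I \<and> (\<forall>x\<in>A. s x = c x)" for c
  proof -
    obtain q where q: "affine_function_on UNIV q" "\<And>x. x \<in> A \<inter> strip_triangle V k \<Longrightarrow> q x = c x"
      using affine_interpolation_3[OF card nc, of c] by blast
    obtain s where s: "s \<in> splines V J"
      "\<And>x. x \<in> A - strip_triangle V k \<Longrightarrow> x \<in> region V J \<Longrightarrow> s x = c x"
      "\<And>p. p \<in> region V J \<Longrightarrow> p \<in> strip_triangle V k \<Longrightarrow> s p = q p"
      using extend_affine_to_part[OF J q(1), of c] by blast
    obtain t where t: "t \<in> splines V K"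
      "\<And>x. x \<in> A - strip_triangle V k \<Longrightarrow> x \<in> region V K \<Longrightarrow> t x = c x"
      "\<And>p. p \<in> region V K \<Longrightarrow> p \<in> strip_triangle V k \<Longrightarrow> t p = q p"
      using extend_affine_to_part[OF K q(1), of c] by blast
    obtain v where v: "v \<in> splines V ({k} \<union> K)"
      "\<And>p. p \<in> strip_triangle V k \<Longrightarrow> v p = q p" "\<And>p. p \<in> region V K \<Longrightarrow> v p = t p"
      using spline_glue[OF _ fin(2) affine_function_in_splines[OF q(1), of V "{k}"] t(1)] t(3)
      by auto
    have "s p = v p" if "p \<in> region V J" "p \<in> region V ({k} \<union> K)" for p
      using that s(3) v(2) sep by (auto simp: region_Un)
    then obtain u where u: "u \<in> splines V ?I"
      "\<And>p. p \<in> region V J \<Longrightarrow> u p = s p" "\<And>p. p \<in> region V ({k} \<union> K) \<Longrightarrow> u p = v p"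
      using spline_glue[OF fin(1) _ s(1) v(1)] fin(2) by blast
    have "u x = c x" if x: "x \<in> A" for x
    proof (cases "x \<in> strip_triangle V k")
      case True
      then show ?thesis using u(3)[of x] v(2)[of x] q(2)[of x] x by (simp add: region_Un)
    next
      case False
      then consider "x \<in> region V J" | "x \<in> region V K" using x sub by (auto simp: region_Un)
      then show ?thesis
        using False x s(2)[of x] t(2)[of x] u(2,3)[of x] v(3)[of x] by cases (auto simp: region_Un)
    qed
    then show ?thesis using u(1) by blast
  qed
  have unique: "s = t" if s: "s \<in> splines V ?I" and t: "t \<in> splines V ?I"
    and st: "\<forall>x\<in>A. s x = t x" for s t
  proof (rule splines_eqI[OF s t])
    fix p assume p: "p \<in> region V ?I"
    have "affine_function_on (strip_triangle V k) (\<lambda>p. s p - t p)"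
      by (intro affine_function_on_diff spline_affine[OF s] spline_affine[OF t]) auto
    from affine_function_vanishes_if_noncollinear_zeros[OF this _ _ nc]
    have k: "s p = t p" if "p \<in> strip_triangle V k" for p using st that by auto
    show "s p = t p"
      using p k part_unique[OF J s t _ _ k] part_unique[OF K s t _ _ k] st by (auto simp: region_Un)
  qed
  show ?thesis by (rule unisolventI[OF exist unique])
qed

text \<open>Three nodes on the side that is shared with the triangle \<open>k\<close> are collinear nodes in a triangle
  of the part: a spline that vanishes at the end points vanishes at the third node.\<close>

lemma no_node_inside_attached_side:
  assumes att: "attached V k J a b" and uni: "unisolvent V J (A \<inter> region V J \<union> {a, b})"
  shows "A \<inter> open_segment a b = {}"
proof (rule ccontr)
  assume "A \<inter> open_segment a b \<noteq> {}"
  then obtain x where x: "x \<in> A" "x \<in> open_segment a b" by blast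
  then have xs: "x \<in> closed_segment a b" "x \<noteq> a" "x \<noteq> b" by (auto simp: open_segment_def)
  have xJ: "x \<in> region V J" using att xs unfolding attached_def by blast
  obtain s where s: "s \<in> splines V J"
    and sN: "\<And>y. y \<in> A \<inter> region V J \<union> {a, b} \<Longrightarrow> s y = (if y = x then 1 else 0)"
    using unisolventE[OF uni, where c = "\<lambda>y. if y = x then 1 else 0"] by blast
  have "s x = 0" using spline_vanishes_on_attached_side[OF att s _ _ xs(1)] sN xs by auto
  then show False using sN[of x] x xJ by simp
qed

lemma reduced_nodes_eq:
  assumes att: "attached V k J a b" and "A \<inter> open_segment a b = {}"
  shows "A \<inter> region V J \<union> {a, b} = (A - strip_triangle V k) \<inter> region V J \<union> {a, b}"
proof -
  have "x \<in> {a, b}" if "x \<in> A" "x \<in> region V J" "x \<in> strip_triangle V k" for x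
  proof -
    have "x \<in> closed_segment a b" using att that unfolding attached_def by blast
    then show ?thesis using assms(2) that by (auto simp: open_segment_def)
  qed
  then show ?thesis by blast
qed

section \<open>The two parts of a strip without one triangle\<close>

lemma strip_left_attached:
  assumes st: "strip V n" and k: "1 < k" "k \<le> n"
  shows "attached V k {1..k-1} (V k) (V (k+1))"
proof -
  have adj: "strip_triangle V (k-1) \<inter> strip_triangle V k = closed_segment (V k) (V (k+1))"
  proof -
    have "1 \<le> k - 1 \<and> (k - 1) + 1 \<le> n" using k by auto
    then have "strip_triangle V (k-1) \<inter> strip_triangle V (k-1+1)
        = closed_segment (V (k-1+1)) (V (k-1+2))"
      using st unfolding strip_def by blast
    moreover have "k - 1 + 1 = k" "k - 1 + 2 = k + 1" using k by auto
    ultimately show ?thesis by metis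
  qed
  have "strip_triangle V l \<inter> strip_triangle V k \<subseteq> closed_segment (V k) (V (k+1))"
    if l: "l \<in> {1..k-1}" for l
  proof -
    consider "l = k - 1" | "l + 2 = k" | "l + 3 \<le> k" using l by fastforce
    then show ?thesis
    proof cases
      case 2
      then have "strip_triangle V l \<inter> strip_triangle V k = {V k}"
        using st l k unfolding strip_def by auto
      then show ?thesis by simp
    next
      case 3
      then have "strip_triangle V l \<inter> strip_triangle V k = {}"
        using st l k unfolding strip_def by auto
      then show ?thesis by simp
    qed (use adj in auto)
  qed
  moreover have "k - 1 \<in> {1..k-1}" using k by simp
  ultimately show ?thesis unfolding attached_def region_def using adj by blast
qed

lemma strip_right_attached:
  assumes st: "strip V n" and k: "1 \<le> k" "k < n"
  shows "attached V k {k+1..n} (V (k+1)) (V (k+2))"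
proof -
  have adj: "strip_triangle V k \<inter> strip_triangle V (k+1) = closed_segment (V (k+1)) (V (k+2))"
    using st k unfolding strip_def by auto
  have "strip_triangle V l \<inter> strip_triangle V k \<subseteq> closed_segment (V (k+1)) (V (k+2))"
    if l: "l \<in> {k+1..n}" for l
  proof -
    consider "l = k + 1" | "l = k + 2" | "k + 3 \<le> l" using l by fastforce
    then show ?thesis
    proof cases
      case 2
      then have "strip_triangle V k \<inter> strip_triangle V l = {V (k+2)}"
        using st l k unfolding strip_def by auto
      then show ?thesis by (metis Int_commute empty_subsetI ends_in_segment(2) insert_subset)
    next
      case 3
      then have "strip_triangle V k \<inter> strip_triangle V l = {}"
        using st l k unfolding strip_def by auto
      then show ?thesis by auto
    qed (use adj in auto)
  qed
  moreover have "k + 1 \<in> {k+1..n}" using k by simp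
  ultimately show ?thesis unfolding attached_def region_def using adj by blast
qed

lemma strip_parts_separated:
  assumes st: "strip V n" and k: "1 \<le> k" "k \<le> n"
  shows "region V {1..k-1} \<inter> region V {k+1..n} \<subseteq> strip_triangle V k"
proof -
  have "strip_triangle V l \<inter> strip_triangle V m \<subseteq> strip_triangle V k"
    if lm: "l \<in> {1..k-1}" "m \<in> {k+1..n}" for l m
  proof (cases "l + 3 \<le> m")
    case True
    then have "strip_triangle V l \<inter> strip_triangle V m = {}"
      using st lm unfolding strip_def by auto
    then show ?thesis by simp
  next
    case False
    then have "l + 2 = m" and m: "m = k + 1" using lm by auto
    then have "strip_triangle V l \<inter> strip_triangle V m = {V m}"
      using st lm unfolding strip_def by auto
    then show ?thesis using vertices_in_strip_triangle[of V k] m by simp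
  qed
  then show ?thesis unfolding region_def by blast
qed

lemma strip_vertices_distinct:
  assumes "strip V n" and "1 \<le> k" and "k \<le> n"
  shows "V k \<noteq> V (k+1)" and "V (k+1) \<noteq> V (k+2)"
proof -
  have "\<not> collinear {V k, V (k+1), V (k+2)}" using assms unfolding strip_def by auto
  then show "V k \<noteq> V (k+1)" "V (k+1) \<noteq> V (k+2)" by auto
qed

lemma card_reduced_nodes:
  assumes "finite A" and "a \<noteq> b" and "a \<in> T" and "b \<in> T"
  shows "card ((A - T) \<inter> R \<union> {a, b}) = card ((A - T) \<inter> R) + 2"
proof -
  have "(A - T) \<inter> R \<inter> {a, b} = {}" using assms by auto
  then show ?thesis using assms by (simp add: card_Un_disjoint)
qed

lemma card_part_le:
  assumes "i \<le> j" and "finite A" and att: "attached V k {i..j} a b" and "a \<noteq> b"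
    and uni: "unisolvent V {i..j} ((A - strip_triangle V k) \<inter> region V {i..j} \<union> {a, b})"
  shows "card ((A - strip_triangle V k) \<inter> region V {i..j}) \<le> card {i..j}"
proof -
  have ab: "a \<in> region V {i..j}" "b \<in> region V {i..j}"
    "a \<in> strip_triangle V k" "b \<in> strip_triangle V k"
    using att unfolding attached_def by (metis IntE ends_in_segment)+
  have solv: "\<exists>s\<in>splines V {i..j}.
      \<forall>x\<in>(A - strip_triangle V k) \<inter> region V {i..j} \<union> {a, b}. s x = c x" for c
    by (rule unisolventE[OF uni, where c = c]) blast
  have "card ((A - strip_triangle V k) \<inter> region V {i..j} \<union> {a, b}) \<le> card {i..j} + 2"
    by (rule card_nodes_le_if_solvable[OF \<open>i \<le> j\<close> _ _ solv]) (use \<open>finite A\<close> ab in auto)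
  then show ?thesis using card_reduced_nodes[OF \<open>finite A\<close> \<open>a \<noteq> b\<close> ab(3,4)] by simp
qed

text \<open>Poisedness transfers by \<open>unisolvent_part\<close> and \<open>unisolvent_from_parts\<close>. Exactness is a count:
  solvability bounds the number of nodes outside the triangle \<open>k\<close> by \<open>k - 1\<close> on the left and by \<open>n - k\<close> on the right, and there are \<open>n - 1\<close> of them altogether.\<close>

lemma poised_iff_reduced_without_triangle:
  assumes st: "strip V n" and sub: "A \<subseteq> carrier_set V 1 n" and ex: "exact_problem 1 n A"
    and k: "1 \<le> k" "k \<le> n"
    and card: "card (A \<inter> strip_triangle V k) = 3" and nc: "\<not> collinear (A \<inter> strip_triangle V k)"
  shows "poised V 1 n A \<longleftrightarrow> reduced_problems_exact_poised V n k (A - strip_triangle V k)"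
proof -
  let ?T = "strip_triangle V k" and ?L = "{1..k-1}" and ?R = "{k+1..n}"
  let ?BL = "(A - ?T) \<inter> region V ?L" and ?BR = "(A - ?T) \<inter> region V ?R"
  have I: "{1..n} = ?L \<union> ({k} \<union> ?R)" using k by auto
  have I': "{1..n} = ?R \<union> ({k} \<union> ?L)" using k by auto
  have finA: "finite A" and cardA: "card A = n + 2" using ex by (auto simp: exact_problem_def)
  have subI: "A \<subseteq> region V {1..n}" using sub by (simp add: carrier_set_eq_region)
  note sep = strip_parts_separated[OF st k]
  note dist = strip_vertices_distinct[OF st k]
  note vert = vertices_in_strip_triangle[of V k]
  have left: "attached V k ?L (V k) (V (k+1))" if "1 < k" by (rule strip_left_attached[OF st that k(2)])
  have right: "attached V k ?R (V (k+1)) (V (k+2))" if "k < n"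
    by (rule strip_right_attached[OF st k(1) that])
  have total: "card ?BL + card ?BR = n - 1"
  proof -
    have "A - ?T = ?BL \<union> ?BR" using subI unfolding I region_Un by auto
    moreover have "?BL \<inter> ?BR = {}" using sep by auto
    ultimately have "card (A - ?T) = card ?BL + card ?BR"
      using card_Un_disjoint[of ?BL ?BR] finA by simp
    moreover have "card (A - ?T) = card A - card (A \<inter> ?T)"
      using finA card_Diff_subset_Int[of A ?T] by simp
    ultimately show ?thesis using cardA card by simp
  qed
  have exL: "exact_problem 1 (k-1) (?BL \<union> {V k, V (k+1)}) \<longleftrightarrow> card ?BL = k - 1"
    unfolding exact_problem_def card_reduced_nodes[OF finA dist(1) vert(1,2)] using finA by simp
  have exR: "exact_problem (k+1) n (?BR \<union> {V (k+1), V (k+2)}) \<longleftrightarrow> card ?BR = n - k"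
    unfolding exact_problem_def card_reduced_nodes[OF finA dist(2) vert(2,3)] using finA by simp
  have red: "reduced_problems_exact_poised V n k (A - ?T) \<longleftrightarrow>
      (1 < k \<longrightarrow> card ?BL = k - 1 \<and> unisolvent V ?L (?BL \<union> {V k, V (k+1)})) \<and>
      (k < n \<longrightarrow> card ?BR = n - k \<and> unisolvent V ?R (?BR \<union> {V (k+1), V (k+2)}))"
    unfolding reduced_problems_exact_poised_def nodes_in_def carrier_set_eq_region
      poised_iff_unisolvent exL exR ..
  show ?thesis
  proof
    assume "poised V 1 n A"
    then have uni: "unisolvent V (?L \<union> ({k} \<union> ?R)) A" "unisolvent V (?R \<union> ({k} \<union> ?L)) A"
      unfolding poised_iff_unisolvent using I I' by simp_all
    have uniL: "unisolvent V ?L (?BL \<union> {V k, V (k+1)})" if "1 < k"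
      by (rule unisolvent_part[OF _ _ left[OF that] dist(1) sep nc uni(1)]) auto
    have uniR: "unisolvent V ?R (?BR \<union> {V (k+1), V (k+2)})" if "k < n"
      by (rule unisolvent_part[OF _ _ right[OF that] dist(2) _ nc uni(2)]) (use sep in auto)
    have "card ?BL \<le> k - 1"
    proof (cases "1 < k")
      case True
      then show ?thesis using card_part_le[OF _ finA left dist(1) uniL] by simp
    qed (use k in simp)
    moreover have "card ?BR \<le> n - k"
    proof (cases "k < n")
      case True
      then show ?thesis using card_part_le[OF _ finA right dist(2) uniR] by simp
    qed (use k in simp)
    ultimately have "card ?BL = k - 1" "card ?BR = n - k" using total k by auto
    then show "reduced_problems_exact_poised V n k (A - ?T)" unfolding red using uniL uniR by blast
  next
    assume "reduced_problems_exact_poised V n k (A - ?T)"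
    then have L: "?L = {} \<or> attached V k ?L (V k) (V (k+1)) \<and> unisolvent V ?L (?BL \<union> {V k, V (k+1)})"
      and R: "?R = {} \<or>
        attached V k ?R (V (k+1)) (V (k+2)) \<and> unisolvent V ?R (?BR \<union> {V (k+1), V (k+2)})"
      unfolding red using left right by fastforce+
    have "unisolvent V (?L \<union> ({k} \<union> ?R)) A"
      by (rule unisolvent_from_parts[OF _ _ L R sep card nc]) (use subI I in auto)
    then show "poised V 1 n A" unfolding poised_iff_unisolvent I .
  qed
qed

lemma reduced_problems_eq_without_triangle:
  assumes st: "strip V n" and k: "1 \<le> k" "k \<le> n" and no: "no_node_inside_shared_sides V n k A"
  shows "reduced_problems_exact_poised V n k A \<longleftrightarrow>
    reduced_problems_exact_poised V n k (A - strip_triangle V k)"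
proof -
  have "nodes_in V 1 (k-1) A \<union> {V k, V (k+1)} =
      nodes_in V 1 (k-1) (A - strip_triangle V k) \<union> {V k, V (k+1)}" if "1 < k"
    unfolding nodes_in_def carrier_set_eq_region
    by (rule reduced_nodes_eq[OF strip_left_attached[OF st that k(2)]])
       (use no that in \<open>simp add: no_node_inside_shared_sides_def\<close>)
  moreover have "nodes_in V (k+1) n A \<union> {V (k+1), V (k+2)} =
      nodes_in V (k+1) n (A - strip_triangle V k) \<union> {V (k+1), V (k+2)}" if "k < n"
    unfolding nodes_in_def carrier_set_eq_region
    by (rule reduced_nodes_eq[OF strip_right_attached[OF st k(1) that]])
       (use no that in \<open>simp add: no_node_inside_shared_sides_def\<close>)
  ultimately show ?thesis
    unfolding reduced_problems_exact_poised_def by (metis (no_types, lifting))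
qed

lemma no_node_inside_shared_sides_if_reduced_poised:
  assumes st: "strip V n" and k: "1 \<le> k" "k \<le> n" and red: "reduced_problems_exact_poised V n k A"
  shows "no_node_inside_shared_sides V n k A"
  using red no_node_inside_attached_side[OF strip_left_attached[OF st _ k(2)], of A]
    no_node_inside_attached_side[OF strip_right_attached[OF st k(1)], of A]
  unfolding no_node_inside_shared_sides_def reduced_problems_exact_poised_def
    nodes_in_def carrier_set_eq_region poised_iff_unisolvent by blast

theorem corollary5p1:
  fixes V :: "nat \<Rightarrow> real^2" and n k :: nat and A :: "(real^2) set"
  assumes "strip V n"
    and "A \<subseteq> carrier_set V 1 n" and "exact_problem 1 n A"
    and "1 \<le> k" and "k \<le> n"
    and "card (A \<inter> strip_triangle V k) = 3" and "\<not> collinear (A \<inter> strip_triangle V k)"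
  shows "(no_node_inside_shared_sides V n k A \<longrightarrow>
            (poised V 1 n A \<longleftrightarrow> reduced_problems_exact_poised V n k A)) \<and>
         (reduced_problems_exact_poised V n k A \<longrightarrow> poised V 1 n A) \<and>
         (poised V 1 n A \<longleftrightarrow>
            reduced_problems_exact_poised V n k (A - strip_triangle V k))"
  using poised_iff_reduced_without_triangle[OF assms]
    reduced_problems_eq_without_triangle[OF assms(1,4,5), of A]
    no_node_inside_shared_sides_if_reduced_poised[OF assms(1,4,5), of A]
  by blast

end
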